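(* Let $p$ be a prime and $n$ an integer with $n\ge 3$ if $p$ is odd and $n\ge 4$ if $p=2$. Let $$M(p^n)=\langle x,y\mid x^{p^{n-1}}=y^p=1,\ y^{-1}xy=x^{p^{n-2}+1}\rangle.$$ Then $$\operatorname{cdeg}(M(p^n))=\frac{(n-1)p+2}{(n-1)p+n+1}.$$
   Context: For a finite group $G$, let $L(G)$ be the set of all subgroups of $G$ and $C(G)$ the set of all cyclic subgroups of $G$. The cyclicity degree of $G$ is $\operatorname{cdeg}(G)=|C(G)|/|L(G)|$. The group $M(p^n)$ has order $p^n$. *)

theory Defs
  imports "HOL-Algebra.Algebra"
begin

text \<open>
  Words over letters with sign: the pair of a letter and \<^const>\<open>True\<close> stands for the letter,
  the pair with \<^const>\<open>False\<close> for its formal inverse.  The free group consists of the classes of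
  words modulo insertion and deletion of adjacent mutually inverse letters.
\<close>

type_synonym 'a word = "('a \<times> bool) list"

definition cancel_step :: "'a word \<Rightarrow> 'a word \<Rightarrow> bool" where
  "cancel_step u v \<longleftrightarrow> (\<exists>xs a b ys. u = xs @ [(a, b), (a, \<not> b)] @ ys \<and> v = xs @ ys)"

definition word_eq :: "('a word \<times> 'a word) set" where
  "word_eq = {(u, v). equivclp cancel_step u v}"

definition free_group :: "'a word set monoid" where
  "free_group =
     \<lparr>carrier = UNIV // word_eq,
      monoid.mult = (\<lambda>A B. \<Union>u\<in>A. \<Union>v\<in>B. word_eq `` {u @ v}),
      monoid.one = word_eq `` {[]}\<rparr>"

definition free_gen :: "'a \<Rightarrow> 'a word set" where
  "free_gen a = word_eq `` {[(a, True)]}"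

definition normal_closure :: "('a, 'b) monoid_scheme \<Rightarrow> 'a set \<Rightarrow> 'a set" where
  "normal_closure G R = (\<lambda>N. N \<lhd> G) hull R"

text \<open>
  The generators are all elements of the type \<^typ>\<open>'a\<close>; the relators are elements of the free
  group on them.
\<close>

definition presented_group :: "'a word set set \<Rightarrow> 'a word set set monoid" where
  "presented_group R = free_group Mod normal_closure free_group R"

datatype xy = Gen_x | Gen_y

text \<open>An equation \<open>u = v\<close> between words enters the presentation as the relator \<open>u v\<^sup>-\<^sup>1\<close>.\<close>

definition M_group :: "nat \<Rightarrow> nat \<Rightarrow> xy word set set monoid" where
  "M_group p n =
     (let F = free_group; x = free_gen Gen_x; y = free_gen Gen_y in
      presented_group
        {x [^]\<^bsub>F\<^esub> (p ^ (n - 1)),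
         y [^]\<^bsub>F\<^esub> p,
         inv\<^bsub>F\<^esub> y \<otimes>\<^bsub>F\<^esub> x \<otimes>\<^bsub>F\<^esub> y \<otimes>\<^bsub>F\<^esub> inv\<^bsub>F\<^esub> (x [^]\<^bsub>F\<^esub> (p ^ (n - 2) + 1))})"

definition subgroups :: "('a, 'b) monoid_scheme \<Rightarrow> 'a set set" where
  "subgroups G = {H. subgroup H G}"

definition cyclic_subgroups :: "('a, 'b) monoid_scheme \<Rightarrow> 'a set set" where
  "cyclic_subgroups G = {H. subgroup H G \<and> cyclic_group (G\<lparr>carrier := H\<rparr>)}"

definition cdeg :: "('a, 'b) monoid_scheme \<Rightarrow> real" where
  "cdeg G = real (card (cyclic_subgroups G)) / real (card (subgroups G))"


lemma equiv_word_eq: "equiv UNIV word_eq"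
  by (rule equivI) (auto simp: word_eq_def refl_on_def intro!: symI transI
      intro: equivclp_sym equivclp_trans)

lemma word_eq_append:
  assumes "(u, u') \<in> word_eq" "(v, v') \<in> word_eq"
  shows "(u @ v, u' @ v') \<in> word_eq"
proof -
  have step: "cancel_step (xs @ s @ ys) (xs @ t @ ys)" if "cancel_step s t" for s t xs ys :: "'a word"
  proof -
    from that obtain as a b bs where "s = as @ [(a, b), (a, \<not> b)] @ bs" "t = as @ bs"
      unfolding cancel_step_def by blast
    then have "xs @ s @ ys = (xs @ as) @ [(a, b), (a, \<not> b)] @ (bs @ ys)"
      "xs @ t @ ys = (xs @ as) @ (bs @ ys)"
      by auto
    then show ?thesis
      unfolding cancel_step_def by blast
  qed
  have ctx: "equivclp cancel_step (xs @ s @ ys) (xs @ t @ ys)" if "equivclp cancel_step s t"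
    for s t xs ys :: "'a word"
    using that
  proof (induction rule: equivclp_induct)
    case base
    show ?case by simp
  next
    case (step t t')
    then have "equivclp cancel_step (xs @ t @ ys) (xs @ t' @ ys)"
      using \<open>\<And>ys xs t s. cancel_step s t \<Longrightarrow> cancel_step (xs @ s @ ys) (xs @ t @ ys)\<close>
      by (meson converse_r_into_equivclp r_into_equivclp)
    with step.IH show ?case
      by (rule equivclp_trans)
  qed
  have "equivclp cancel_step (u @ v) (u' @ v)"
    using ctx[of u u' "[]" v] assms(1) by (simp add: word_eq_def)
  moreover have "equivclp cancel_step (u' @ v) (u' @ v')"
    using ctx[of v v' u' "[]"] assms(2) by (simp add: word_eq_def)
  ultimately show ?thesis
    unfolding word_eq_def by (auto intro: equivclp_trans)
qed

lemma free_group_mult_class: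
  "word_eq `` {u} \<otimes>\<^bsub>free_group\<^esub> word_eq `` {v} = word_eq `` {u @ v}"
proof -
  have "(\<lambda>u v. word_eq `` {u @ v}) respects2 word_eq"
    by (rule congruent2I'[where ?r1.0 = word_eq and ?r2.0 = word_eq])
      (metis equiv_class_eq[OF equiv_word_eq] word_eq_append)
  from UN_equiv_class2[OF equiv_word_eq equiv_word_eq this]
  show ?thesis by (simp add: free_group_def)
qed

lemma group_free_group: "group (free_group :: 'a word set monoid)"
proof (rule groupI)
  show "\<one>\<^bsub>free_group\<^esub> \<in> carrier (free_group :: 'a word set monoid)"
    by (simp add: free_group_def quotientI)
next
  fix A :: "'a word set" assume "A \<in> carrier free_group"
  then obtain u where A: "A = word_eq `` {u}"
    by (auto simp: free_group_def elim: quotientE)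
  show "\<one>\<^bsub>free_group\<^esub> \<otimes>\<^bsub>free_group\<^esub> A = A"
    using free_group_mult_class[of "[]" u] by (simp add: A free_group_def)
  define w where "w = rev (map (\<lambda>(a, b). (a, \<not> b)) u)"
  have "(w @ u, []) \<in> word_eq"
    unfolding w_def
  proof (induction u)
    case Nil
    show ?case by (simp add: word_eq_def)
  next
    case (Cons z u)
    obtain a b where z: "z = (a, b)" by fastforce
    let ?v = "rev (map (\<lambda>(a, b). (a, \<not> b)) u)"
    have "cancel_step (?v @ [(a, \<not> b), (a, \<not> \<not> b)] @ u) (?v @ u)"
      unfolding cancel_step_def by blast
    then have "equivclp cancel_step (rev (map (\<lambda>(a, b). (a, \<not> b)) (z # u)) @ z # u) (?v @ u)"
      by (auto simp: z intro: r_into_equivclp)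
    with Cons.IH show ?case
      by (auto simp: word_eq_def intro: equivclp_trans)
  qed
  then have "word_eq `` {w} \<otimes>\<^bsub>free_group\<^esub> A = \<one>\<^bsub>free_group\<^esub>"
    by (simp add: A free_group_mult_class equiv_class_eq[OF equiv_word_eq])
      (simp add: free_group_def)
  moreover have "word_eq `` {w} \<in> carrier free_group"
    by (simp add: free_group_def quotientI)
  ultimately show "\<exists>B\<in>carrier free_group. B \<otimes>\<^bsub>free_group\<^esub> A = \<one>\<^bsub>free_group\<^esub>"
    by blast
next
  fix A B :: "'a word set" assume AB: "A \<in> carrier free_group" "B \<in> carrier free_group"
  then obtain u v where A: "A = word_eq `` {u}" and B: "B = word_eq `` {v}"
    by (auto simp: free_group_def elim!: quotientE)
  show "A \<otimes>\<^bsub>free_group\<^esub> B \<in> carrier free_group"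
    unfolding A B free_group_mult_class by (simp add: free_group_def quotientI)
  fix C :: "'a word set" assume "C \<in> carrier free_group"
  then obtain w where C: "C = word_eq `` {w}"
    by (auto simp: free_group_def elim!: quotientE)
  show "A \<otimes>\<^bsub>free_group\<^esub> B \<otimes>\<^bsub>free_group\<^esub> C = A \<otimes>\<^bsub>free_group\<^esub> (B \<otimes>\<^bsub>free_group\<^esub> C)"
    by (simp add: A B C free_group_mult_class)
qed

lemma free_gen_closed: "free_gen a \<in> carrier free_group"
  by (simp add: free_gen_def free_group_def quotientI)

lemma (in group) normal_closure_normal:
  assumes "R \<subseteq> carrier G"
  shows "normal_closure G R \<lhd> G"
proof -
  let ?S = "{N. N \<lhd> G \<and> R \<subseteq> N}"
  have eq: "normal_closure G R = \<Inter>?S"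
    by (simp add: normal_closure_def hull_def conj_commute)
  have mem: "carrier G \<in> ?S"
    using assms by (auto simp: normal_inv_iff subgroup_self)
  have "subgroup (\<Inter>?S) G"
    using mem by (intro subgroups_Inter) (auto simp: normal_imp_subgroup)
  moreover have "x \<otimes> h \<otimes> inv x \<in> \<Inter>?S" if "x \<in> carrier G" "h \<in> \<Inter>?S" for x h
    using that by (auto simp: normal_inv_iff)
  ultimately show ?thesis
    unfolding eq normal_inv_iff by blast
qed

lemma group_presented_group:
  assumes "R \<subseteq> carrier free_group"
  shows "group (presented_group R)"
  unfolding presented_group_def
  by (rule normal.factorgroup_is_group[OF group.normal_closure_normal[OF group_free_group assms]])

lemma group_M_group: "group (M_group p n)"
proof -
  interpret F: group "free_group :: xy word set monoid"
    by (rule group_free_group)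
  show ?thesis
    unfolding M_group_def Let_def
    by (rule group_presented_group) (simp add: free_gen_closed)
qed

end

theory Submission
  imports Defs
begin

text \<open>
  Put \<open>q = p\<^sup>n\<^sup>-\<^sup>1\<close> and \<open>r = p\<^sup>n\<^sup>-\<^sup>2\<close>.  Every element of the group is \<open>y\<^sup>b x\<^sup>a\<close> with \<open>b\<close>
  determined modulo \<open>p\<close> and \<open>a\<close> modulo \<open>q\<close>, and since \<open>q\<close> divides \<open>r\<^sup>2\<close>,
  \<open>y\<^sup>b x\<^sup>a \<cdot> y\<^sup>d x\<^sup>c = y\<^sup>b\<^sup>+\<^sup>d x\<^sup>a\<^sup>+\<^sup>c\<^sup>+\<^sup>a\<^sup>d\<^sup>r\<close>.  A subgroup containing \<open>y\<^sup>b x\<^sup>a\<close> contains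
  every \<open>x\<^sup>a\<^sup>d\<^sup>r\<close>, so the exponent pairs of its elements form an additive subgroup of
  \<open>\<int> \<times> \<int>\<close>; the same argument works backwards.  Subgroups therefore correspond to the
  subgroups of \<open>\<int> \<times> \<int>\<close> that contain \<open>(p, 0)\<close> and \<open>(0, q)\<close>, that is, to the subgroups of
  \<open>\<int>\<^sub>p \<times> \<int>\<^sub>q\<close>, and cyclic ones to cyclic ones.  These are classified by their intersection
  with \<open>0 \<times> \<int>\<close> and their projection to the first factor.
\<close>

section \<open>Lattices of periods\<close>

text \<open>Being nonempty, a set closed under differences is a subgroup. Integer pairs take the
  place of residues, so that exponents never have to be reduced.\<close>

definition period_lattices :: "int \<Rightarrow> int \<Rightarrow> (int \<times> int) set set" where
  "period_lattices s t = {L. (s, 0) \<in> L \<and> (0, t) \<in> L \<and>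
     (\<forall>b a d c. (b, a) \<in> L \<longrightarrow> (d, c) \<in> L \<longrightarrow> (b - d, a - c) \<in> L)}"

text \<open>
  For the set \<open>S\<close> of all subgroups this says that \<open>H\<close> is generated by one element.  Phrased
  through \<open>S\<close> alone, it is carried along by any bijection that matches up the subgroups.
\<close>

definition cyclic_over :: "'a set set \<Rightarrow> 'a set \<Rightarrow> bool" where
  "cyclic_over S H \<longleftrightarrow> (\<exists>v\<in>H. \<forall>H'\<in>S. v \<in> H' \<longrightarrow> H \<subseteq> H')"

section \<open>Closure properties of lattices of periods\<close>

lemma period_lattices_diff:
  assumes "L \<in> period_lattices s t" "(b, a) \<in> L" "(d, c) \<in> L"
  shows "(b - d, a - c) \<in> L"
  using assms unfolding period_lattices_def by blast

lemma period_lattices_zero: "L \<in> period_lattices s t \<Longrightarrow> (0, 0) \<in> L"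
  using period_lattices_diff[of L s t s 0 s 0] by (simp add: period_lattices_def)

lemma period_lattices_uminus:
  "L \<in> period_lattices s t \<Longrightarrow> (b, a) \<in> L \<Longrightarrow> (- b, - a) \<in> L"
  using period_lattices_diff[of L s t 0 0 b a] period_lattices_zero[of L s t] by simp

lemma period_lattices_add:
  assumes "L \<in> period_lattices s t" "(b, a) \<in> L" "(d, c) \<in> L"
  shows "(b + d, a + c) \<in> L"
  using period_lattices_diff[OF assms(1,2) period_lattices_uminus[OF assms(1,3)]] by simp

lemma period_lattices_scale:
  assumes "L \<in> period_lattices s t" "(b, a) \<in> L"
  shows "(k * b, k * a) \<in> L"
proof (induction k rule: int_induct[where k = 0])
  case base
  show ?case using period_lattices_zero[OF assms(1)] by simp
next
  case (step1 i)
  show ?case using period_lattices_add[OF assms(1) step1(2) assms(2)] by (simp add: algebra_simps)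
next
  case (step2 i)
  show ?case using period_lattices_diff[OF assms(1) step2(2) assms(2)] by (simp add: algebra_simps)
qed

lemma period_lattices_fst:
  assumes "L \<in> period_lattices s t" "s dvd b"
  shows "(b, 0) \<in> L"
  using assms period_lattices_scale[OF assms(1), of s 0]
  by (auto simp: period_lattices_def dvd_def mult.commute)

lemma period_lattices_snd_dvd:
  assumes "L \<in> period_lattices s t" "(0, a) \<in> L" "a dvd c"
  shows "(0, c) \<in> L"
  using assms period_lattices_scale[OF assms(1,2)]
  by (auto simp: dvd_def mult.commute)

lemma period_lattices_gcd:
  assumes L: "L \<in> period_lattices s t" and "(0, a) \<in> L"
  shows "(0, gcd a t) \<in> L"
proof -
  obtain u v where "u * a + v * t = gcd a t"
    using bezout_int by blast
  moreover have "(u * 0 + v * 0, u * a + v * t) \<in> L"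
    using L assms(2) by (intro period_lattices_add[OF L] period_lattices_scale[OF L])
      (auto simp: period_lattices_def)
  ultimately show ?thesis by simp
qed

section \<open>Classification and count of the lattices\<close>

locale prime_power_periods =
  fixes p :: int and m :: nat
  assumes prime_p: "Factorial_Ring.prime p"
begin

abbreviation \<Lambda> :: "(int \<times> int) set set" where
  "\<Lambda> \<equiv> period_lattices p (p ^ m)"

definition split_lattice :: "nat \<Rightarrow> (int \<times> int) set" where
  "split_lattice i = {(b, a). p dvd b \<and> p ^ i dvd a}"

text \<open>This is the lattice spanned by \<open>(1, c * p ^ j)\<close> and
  \<open>(0, p ^ Suc j)\<close>, so \<open>c\<close> matters only modulo \<open>p\<close>.\<close>

definition skew_lattice :: "nat \<Rightarrow> int \<Rightarrow> (int \<times> int) set" where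
  "skew_lattice j c = {(b, a). p ^ Suc j dvd a - b * c * p ^ j}"

text \<open>Not a further family: \<open>full_lattice 0\<close> is \<open>UNIV\<close> and
  \<open>full_lattice (Suc j)\<close> is \<open>skew_lattice j 0\<close>. For \<open>k < m\<close>
  these are the lattices that need two generators modulo the periods.\<close>

definition full_lattice :: "nat \<Rightarrow> (int \<times> int) set" where
  "full_lattice k = {(b, a). p ^ k dvd a}"

lemma p_gt_1: "p > 1"
  using prime_p prime_gt_1_int by blast

lemma p_coprime: "\<not> p dvd a \<Longrightarrow> \<exists>u k. u * a = 1 + k * p"
proof -
  assume "\<not> p dvd a"
  then have "coprime p a"
    using prime_p prime_imp_coprime by blast
  then obtain u v where "u * a + v * p = 1"
    using bezout_int[of a p] by (metis coprime_iff_gcd_eq_1 gcd.commute)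
  then have "u * a = 1 + (- v) * p" by simp
  then show ?thesis by blast
qed

lemma gcd_power_mult:
  assumes "\<not> p dvd a" "j \<le> m"
  shows "gcd (p ^ j * a) (p ^ m) = p ^ j"
proof -
  have "coprime a (p ^ (m - j))"
    using assms(1) prime_p by (metis coprime_commute coprime_power_left_iff prime_imp_coprime)
  moreover have "p ^ m = p ^ j * p ^ (m - j)"
    using assms(2) by (simp flip: power_add)
  ultimately show ?thesis
    using p_gt_1 by (simp add: gcd_mult_left)
qed

lemma power_in_lattice:
  assumes "L \<in> \<Lambda>" "(0, p ^ j * a) \<in> L" "\<not> p dvd a" "j \<le> m"
  shows "(0, p ^ j) \<in> L"
  using period_lattices_gcd[OF assms(1,2)] gcd_power_mult[OF assms(3,4)] by simp

text \<open>The fibre is a subgroup of the integers containing \<open>p ^ m\<close>, so its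
  generator divides \<open>p ^ m\<close> and is a power of \<open>p\<close>. Concretely, for
  \<open>a\<close> in the fibre, gcd of \<open>a\<close> and \<open>p ^ m\<close> is a power of
  \<open>p\<close> in the fibre, and its exponent is at least the least one.\<close>

lemma fibre_over_zero:
  assumes L: "L \<in> \<Lambda>"
  obtains i where "i \<le> m" "\<And>a. (0, a) \<in> L \<longleftrightarrow> p ^ i dvd a"
proof -
  define i where "i = (LEAST i. (0, p ^ i) \<in> L)"
  have m: "(0, p ^ m) \<in> L" using L by (simp add: period_lattices_def)
  have i: "(0, p ^ i) \<in> L" unfolding i_def using m by (rule LeastI)
  have "i \<le> m" unfolding i_def using m by (rule Least_le)
  moreover have "p ^ i dvd a" if "(0, a) \<in> L" for a
  proof -
    have "gcd a (p ^ m) dvd p ^ m" by simp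
    then obtain k where "gcd a (p ^ m) = p ^ k"
      using divides_primepow[OF prime_p] by (metis normalize_gcd)
    moreover from this have "i \<le> k"
      unfolding i_def using period_lattices_gcd[OF L that] by (auto intro: Least_le)
    ultimately show ?thesis
      by (metis dvd_trans gcd_dvd1 le_imp_power_dvd)
  qed
  ultimately show ?thesis
    using that period_lattices_snd_dvd[OF L i] by blast
qed

lemma split_lattice_mem: "i \<le> m \<Longrightarrow> split_lattice i \<in> \<Lambda>"
  by (auto simp: period_lattices_def split_lattice_def le_imp_power_dvd)

lemma skew_lattice_mem: "j < m \<Longrightarrow> skew_lattice j c \<in> \<Lambda>"
proof -
  assume "j < m"
  then have "p ^ Suc j dvd p ^ m" by (intro le_imp_power_dvd) simp
  moreover have "p ^ Suc j dvd (a - c') - (b - d) * c * p ^ j"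
    if "p ^ Suc j dvd a - b * c * p ^ j" "p ^ Suc j dvd c' - d * c * p ^ j" for a b c' d
    using dvd_diff[OF that] by (simp add: algebra_simps)
  ultimately show ?thesis
    by (simp add: period_lattices_def skew_lattice_def del: power_Suc)
qed

text \<open>The projection to the first factor contains the prime \<open>p\<close>, so it consists
  of the multiples of \<open>p\<close> or of all integers. In the first case \<open>L\<close> is a
  product. In the second it contains some \<open>(1, e)\<close> and is determined by
  \<open>e\<close> and the fibre over 0; since \<open>(p, 0)\<close> lies in \<open>L\<close>, the
  generator of that fibre divides \<open>p * e\<close>.\<close>

lemma lattice_cases:
  assumes L: "L \<in> \<Lambda>"
  shows "L = UNIV \<or> (\<exists>i\<le>m. L = split_lattice i) \<or> (\<exists>j<m. \<exists>c\<in>{0..<p}. L = skew_lattice j c)"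
proof -
  obtain i where i: "i \<le> m" and fib: "\<And>a. (0, a) \<in> L \<longleftrightarrow> p ^ i dvd a"
    using fibre_over_zero[OF L] by blast
  show ?thesis
  proof (cases "\<forall>b a. (b, a) \<in> L \<longrightarrow> p dvd b")
    case True
    have "(b, a) \<in> L \<longleftrightarrow> p dvd b \<and> p ^ i dvd a" for b a
      using True period_lattices_fst[OF L, of b] period_lattices_diff[OF L, of b a b 0]
        period_lattices_add[OF L, of b 0 0 a] fib by auto
    then have "L = split_lattice i" by (auto simp: split_lattice_def)
    with i show ?thesis by blast
  next
    case False
    then obtain b a where ba: "(b, a) \<in> L" "\<not> p dvd b" by blast
    then obtain u k where "u * b = 1 + k * p" using p_coprime by blast
    then have "(1 + k * p, u * a) \<in> L"
      using period_lattices_scale[OF L ba(1), of u] by simp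
    then have one: "(1, u * a) \<in> L"
      using period_lattices_diff[OF L _ period_lattices_fst[OF L, of "k * p"]] by fastforce
    \<comment> \<open>Any \<open>(1, c)\<close> in \<open>L\<close> may serve here. The fact is used
      first for \<open>u * a\<close> and then for a normalised representative.\<close>
    have mem: "(b, a) \<in> L \<longleftrightarrow> p ^ i dvd a - b * c" if "(1, c) \<in> L" for a b c
      using period_lattices_scale[OF L that, of b] fib
        period_lattices_diff[OF L, of b a b "b * c"] period_lattices_add[OF L, of b "b * c" 0 "a - b * c"]
      by auto
    show ?thesis
    proof (cases i)
      case 0
      then show ?thesis using mem[OF one] by auto
    next
      case (Suc j)
      have "p ^ i dvd p * (u * a)"
        using mem[OF one, of p 0] L by (auto simp: period_lattices_def)
      then obtain c where c: "u * a = p ^ j * c"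
        using p_gt_1 Suc by auto
      \<comment> \<open>Changing \<open>c\<close> by a multiple of \<open>p\<close> changes
        \<open>p ^ j * c\<close> by a multiple of \<open>p ^ i\<close>, so the slope may be reduced
        to the range \<open>{0..<p}\<close>.\<close>
      have "p ^ i dvd p ^ j * (c mod p) - 1 * (u * a)"
        unfolding c Suc by (simp flip: right_diff_distrib add: mod_eq_dvd_iff[symmetric])
      then have "(1, p ^ j * (c mod p)) \<in> L"
        using mem[OF one] by blast
      from mem[OF this] have "L = skew_lattice j (c mod p)"
        by (auto simp: skew_lattice_def Suc mult_ac)
      moreover have "c mod p \<in> {0..<p}" using p_gt_1 by simp
      ultimately show ?thesis
        using i Suc Suc_le_lessD by blast
    qed
  qed
qed

lemma lattices_eq:
  "\<Lambda> = insert UNIV (split_lattice ` {..m} \<union> (\<lambda>(j, c). skew_lattice j c) ` ({..<m} \<times> {0..<p}))"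
  using lattice_cases split_lattice_mem skew_lattice_mem
  by (fastforce simp: period_lattices_def)

lemma pow_dvd_pow_iff: "p ^ i dvd p ^ j \<longleftrightarrow> i \<le> j"
  using p_gt_1 by (simp add: dvd_power_iff)

lemma inj_split_lattice: "inj split_lattice"
proof (rule injI)
  fix i j assume "split_lattice i = split_lattice j"
  then have "(0, p ^ k) \<in> split_lattice i \<longleftrightarrow> (0, p ^ k) \<in> split_lattice j" for k by simp
  then have "i \<le> k \<longleftrightarrow> j \<le> k" for k by (simp add: split_lattice_def pow_dvd_pow_iff)
  then show "i = j" using le_antisym by blast
qed

text \<open>The powers of \<open>p\<close> on the second axis recover \<open>j\<close>, and the
  point \<open>(1, c * p ^ j)\<close> then recovers \<open>c\<close> modulo
  \<open>p\<close>.\<close>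

lemma inj_skew_lattice: "inj_on (\<lambda>(j, c). skew_lattice j c) (UNIV \<times> {0..<p})"
proof (rule inj_onI, clarsimp)
  fix i c j d
  assume eq: "skew_lattice i c = skew_lattice j d" and cd: "0 \<le> c" "c < p" "0 \<le> d" "d < p"
  have "(0, p ^ k) \<in> skew_lattice i c \<longleftrightarrow> (0, p ^ k) \<in> skew_lattice j d" for k
    using eq by simp
  then have "Suc i \<le> k \<longleftrightarrow> Suc j \<le> k" for k
    by (simp only: skew_lattice_def pow_dvd_pow_iff mem_Collect_eq prod.case mult_zero_left diff_zero)
  then have ij: "i = j" by (metis Suc_inject le_antisym order_refl)
  have "(1, c * p ^ i) \<in> skew_lattice i c"
    by (simp add: skew_lattice_def)
  then have "(1, c * p ^ i) \<in> skew_lattice j d"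
    unfolding eq .
  then have "p * p ^ i dvd (c - d) * p ^ i"
    by (simp add: skew_lattice_def ij algebra_simps)
  then have "p dvd c - d" using p_gt_1 by simp
  then have "c = d" using cd by (metis mod_eq_dvd_iff mod_pos_pos_trivial)
  with ij show "i = j \<and> c = d" by simp
qed

text \<open>There are \<open>m + 1\<close> split lattices, \<open>m * p\<close> skew ones, and
  \<open>UNIV\<close>. A point with first coordinate 1 separates skew from split, and
  \<open>(0, 1)\<close> lies in no skew lattice.\<close>

lemma card_lattices: "card \<Lambda> = m + 2 + m * nat p"
proof -
  let ?S = "split_lattice ` {..m}" and ?T = "(\<lambda>(j, c). skew_lattice j c) ` ({..<m} \<times> {0..<p})"
  have "?S \<inter> ?T = {}"
  proof -
    have "(1, c * p ^ j) \<in> skew_lattice j c" "(1, c * p ^ j) \<notin> split_lattice i" for i j c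
      using p_gt_1 by (auto simp: skew_lattice_def split_lattice_def)
    then have "split_lattice i \<noteq> skew_lattice j c" for i j c by metis
    then show ?thesis by auto
  qed
  moreover have "UNIV \<notin> ?S \<union> ?T"
  proof -
    have "(1, 0) \<notin> split_lattice i" "(0, 1) \<notin> skew_lattice j c" for i j c
      using p_gt_1 pow_dvd_pow_iff[of "Suc j" 0] by (auto simp: split_lattice_def skew_lattice_def)
    then have "split_lattice i \<noteq> UNIV" "skew_lattice j c \<noteq> UNIV" for i j c by blast+
    then show ?thesis by force
  qed
  moreover have "card ?S = m + 1"
    using inj_split_lattice by (subst card_image) (auto intro: inj_on_subset)
  moreover have "card ?T = m * nat p"
    using inj_skew_lattice by (subst card_image) (auto intro: inj_on_subset simp: card_cartesian_product)
  ultimately show ?thesis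
    unfolding lattices_eq by (simp add: card_Un_disjoint)
qed

section \<open>Cyclic lattices\<close>

lemma full_lattice_not_cyclic:
  assumes "k < m"
  shows "\<not> cyclic_over \<Lambda> (full_lattice k)"
proof
  assume "cyclic_over \<Lambda> (full_lattice k)"
  then obtain b a where ba: "p ^ k dvd a"
    and gen: "\<And>L. L \<in> \<Lambda> \<Longrightarrow> (b, a) \<in> L \<Longrightarrow> full_lattice k \<subseteq> L"
    unfolding cyclic_over_def by (force simp: full_lattice_def)
  show False
  \<comment> \<open>For each candidate generator \<open>(b, a)\<close> there is a lattice through it
    that does not contain \<open>full_lattice k\<close>: a split one missing \<open>(1, 0)\<close>,
    or a skew one missing \<open>(0, p ^ k)\<close>.\<close>
  proof (cases "p dvd b")
    case True
    then have "full_lattice k \<subseteq> split_lattice k"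
      using gen[OF split_lattice_mem[of k]] assms ba by (simp add: split_lattice_def)
    then have "(1, 0) \<in> split_lattice k"
      by (auto simp: full_lattice_def)
    then show False using p_gt_1 by (simp add: split_lattice_def)
  next
    case False
    then obtain u l where u: "u * b = 1 + l * p" using p_coprime by blast
    obtain a' where a': "a = p ^ k * a'" using ba by auto
    \<comment> \<open>As \<open>u\<close> inverts \<open>b\<close> modulo \<open>p\<close>, the
      slope \<open>a' * u\<close> is the one whose skew lattice passes through
      \<open>(b, a)\<close>.\<close>
    have "a - b * (a' * u) * p ^ k = p ^ Suc k * (- a' * l)"
      using arg_cong[OF u, of "\<lambda>z. a' * p ^ k * z"] by (simp add: a' algebra_simps)
    then have "(b, a) \<in> skew_lattice k (a' * u)"
      unfolding skew_lattice_def by (simp del: power_Suc)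
    then have "full_lattice k \<subseteq> skew_lattice k (a' * u)"
      using gen skew_lattice_mem assms by blast
    then have "(0, p ^ k) \<in> skew_lattice k (a' * u)"
      by (auto simp: full_lattice_def)
    then show False
      using pow_dvd_pow_iff[of "Suc k" k] by (simp add: skew_lattice_def)
  qed
qed

text \<open>Every lattice already contains \<open>(p, 0)\<close>, so \<open>(0, p ^ i)\<close>
  generates.\<close>

lemma split_lattice_cyclic:
  "cyclic_over \<Lambda> (split_lattice i)"
  unfolding cyclic_over_def
proof (intro bexI[where x = "(0, p ^ i)"] ballI impI subsetI)
  fix L v assume L: "L \<in> \<Lambda>" "(0, p ^ i) \<in> L" and "v \<in> split_lattice i"
  then obtain b a where v: "v = (b, a)" "p dvd b" "p ^ i dvd a" by (auto simp: split_lattice_def)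
  show "v \<in> L"
    using period_lattices_add[OF L(1) period_lattices_fst[OF L(1) v(2)] period_lattices_snd_dvd[OF L v(3)]]
    by (simp add: v(1))
qed (simp add: split_lattice_def)

text \<open>The generator is \<open>(1, c * p ^ j)\<close>. Subtracting \<open>(p, 0)\<close> from
  its \<open>p\<close>-fold multiple leaves \<open>(0, c * p ^ Suc j)\<close>, which yields
  \<open>(0, p ^ Suc j)\<close> when \<open>c\<close> is prime to \<open>p\<close>. If
  \<open>Suc j = m\<close>, this last point is a period anyway.\<close>

lemma skew_lattice_cyclic:
  assumes "j < m" and "\<not> p dvd c \<or> Suc j = m"
  shows "cyclic_over \<Lambda> (skew_lattice j c)"
  unfolding cyclic_over_def
proof (intro bexI[where x = "(1, c * p ^ j)"] ballI impI subsetI)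
  fix L v assume L: "L \<in> \<Lambda>" "(1, c * p ^ j) \<in> L" and "v \<in> skew_lattice j c"
  then obtain b a where v: "v = (b, a)" "p ^ Suc j dvd a - b * c * p ^ j"
    by (auto simp: skew_lattice_def)
  have "(0, p ^ Suc j) \<in> L"
  proof (cases "Suc j = m")
    case True
    then show ?thesis using L by (auto simp: period_lattices_def)
  next
    case False
    have "(p - p, p * (c * p ^ j) - 0) \<in> L"
      using period_lattices_scale[OF L, of p] L
      by (intro period_lattices_diff[OF L(1)]) (auto simp: period_lattices_def)
    then have "(0, p ^ Suc j * c) \<in> L" by (simp add: mult_ac)
    then show ?thesis using power_in_lattice[OF L(1), of "Suc j" c] False assms by auto
  qed
  then have "(0, a - b * c * p ^ j) \<in> L"
    using period_lattices_snd_dvd[OF L(1)] v(2) by blast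
  from period_lattices_add[OF L(1) period_lattices_scale[OF L, of b] this] show "v \<in> L"
    by (simp add: v(1) mult_ac)
qed (simp add: skew_lattice_def)

text \<open>The non-cyclic lattices are exactly the \<open>m\<close> lattices
  \<open>full_lattice k\<close> with \<open>k < m\<close>, which are subtracted from the
  total.\<close>

lemma card_cyclic_lattices: "card {L \<in> \<Lambda>. cyclic_over \<Lambda> L} = m * nat p + 2"
proof -
  have full: "full_lattice 0 = UNIV" "full_lattice (Suc j) = skew_lattice j 0" for j
    by (auto simp: full_lattice_def skew_lattice_def)
  have mem: "full_lattice k \<in> \<Lambda>" if "k < m" for k
    using that skew_lattice_mem by (cases k) (auto simp: full period_lattices_def)
  have cyc: "cyclic_over \<Lambda> L" if L: "L \<in> \<Lambda>" and nf: "L \<notin> full_lattice ` {..<m}" for L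
    using lattice_cases[OF L]
  proof (elim disjE exE conjE bexE)
    assume U: "L = UNIV"
    \<comment> \<open>\<open>UNIV\<close> is \<open>full_lattice 0\<close>, which \<open>nf\<close>
      excludes as soon as \<open>m\<close> is positive. For \<open>m = 0\<close> the second factor
      is trivial and \<open>(1, 0)\<close> generates.\<close>
    have "m = 0"
    proof (rule ccontr)
      assume "m \<noteq> 0"
      then have "full_lattice 0 \<in> full_lattice ` {..<m}" by auto
      with nf U full show False by simp
    qed
    then have "UNIV \<subseteq> L'" if L': "L' \<in> \<Lambda>" "(1, 0) \<in> L'" for L'
    proof -
      have "(b, a) \<in> L'" for b a
        using period_lattices_add[OF L'(1) period_lattices_scale[OF L', of b]
            period_lattices_snd_dvd[OF L'(1), of 1 a]] L' \<open>m = 0\<close>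
        by (simp add: period_lattices_def)
      then show ?thesis by auto
    qed
    then show ?thesis unfolding cyclic_over_def U by blast
  next
    fix i assume "L = split_lattice i"
    then show ?thesis using split_lattice_cyclic by blast
  next
    fix j c assume *: "j < m" "c \<in> {0..<p}" "L = skew_lattice j c"
    \<comment> \<open>In the range \<open>{0..<p}\<close> only 0 is divisible by \<open>p\<close>,
      which makes \<open>L\<close> equal to \<open>full_lattice (Suc j)\<close>.\<close>
    have "Suc j = m" if "p dvd c"
    proof -
      have "c = 0" using * that by (auto dest: zdvd_imp_le)
      then have "L = full_lattice (Suc j)" using * full by simp
      then show ?thesis using nf * by (metis Suc_lessI image_eqI lessThan_iff)
    qed
    then show ?thesis using skew_lattice_cyclic * by blast
  qed
  have "{L \<in> \<Lambda>. cyclic_over \<Lambda> L} = \<Lambda> - full_lattice ` {..<m}"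
    using cyc full_lattice_not_cyclic by blast
  moreover have "inj full_lattice"
  proof (rule injI)
    fix i j assume "full_lattice i = full_lattice j"
    then have "(0, p ^ k) \<in> full_lattice i \<longleftrightarrow> (0, p ^ k) \<in> full_lattice j" for k by simp
    then have "i \<le> k \<longleftrightarrow> j \<le> k" for k by (simp add: full_lattice_def pow_dvd_pow_iff)
    then show "i = j" using le_antisym by blast
  qed
  then have "card (full_lattice ` {..<m}) = m"
    by (subst card_image) (auto intro: inj_on_subset)
  moreover have "full_lattice ` {..<m} \<subseteq> \<Lambda>" using mem by blast
  ultimately show ?thesis
    using card_lattices by (simp add: card_Diff_subset)
qed

end

section \<open>Subgroups and lattices of exponents\<close>

lemma (in group) int_pow_eqI:
  assumes "g \<in> carrier G" "g [^] (n :: int) = \<one>" "n dvd a - c"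
  shows "g [^] a = g [^] c"
proof -
  obtain k where "a = n * k + c"
    using assms(3) by (metis diff_eq_eq dvdE)
  then show ?thesis
    using assms(1,2) by (simp add: int_pow_mult flip: int_pow_pow)
qed

text \<open>Conjugation by \<open>h\<close> is a homomorphism taking \<open>g\<close> to
  \<open>z\<close>, so it takes powers of \<open>g\<close> to powers of \<open>z\<close>.\<close>

lemma (in group) int_pow_push:
  assumes "g \<in> carrier G" "h \<in> carrier G" "z \<in> carrier G" and eq: "g \<otimes> h = h \<otimes> z"
  shows "g [^] (i :: int) \<otimes> h = h \<otimes> z [^] i"
proof (induction i rule: int_induct[where k = 0])
  case base
  show ?case using assms by simp
next
  case (step1 i)
  have "g [^] (i + 1) \<otimes> h = g [^] i \<otimes> h \<otimes> z"
    using assms by (simp add: int_pow_mult m_assoc)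
  also have "\<dots> = h \<otimes> z [^] (i + 1)"
    using assms by (simp add: step1 int_pow_mult m_assoc)
  finally show ?case .
next
  case (step2 i)
  have split: "w [^] i = w [^] (i - 1) \<otimes> w" if "w \<in> carrier G" for w
    using int_pow_mult[OF that, of "i - 1" 1] that by simp
  \<comment> \<open>For the downward step both sides are multiplied by \<open>z\<close> on the
    right, which brings the exponent back to \<open>i\<close>; \<open>z\<close> is cancelled at the
    end.\<close>
  have "g [^] (i - 1) \<otimes> h \<otimes> z = g [^] i \<otimes> h"
    using assms by (simp add: split m_assoc)
  also have "\<dots> = h \<otimes> z [^] (i - 1) \<otimes> z"
    using assms by (simp add: step2(2)) (simp add: split m_assoc)
  finally show ?case
    using assms by simp
qed

text \<open>The subgroup generated by \<open>g\<close> is the least one containing \<open>g\<close>,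
  and it is itself a member of \<open>subgroups G\<close>.\<close>

lemma (in group) cyclic_subgroup_iff:
  assumes H: "subgroup H G"
  shows "cyclic_group (G\<lparr>carrier := H\<rparr>) \<longleftrightarrow> cyclic_over (subgroups G) H"
proof -
  interpret H: group "G\<lparr>carrier := H\<rparr>"
    using H by (rule subgroup_imp_group)
  have sub: "H \<subseteq> carrier G" using H by (rule subgroup.subset)
  have "cyclic_group (G\<lparr>carrier := H\<rparr>) \<longleftrightarrow> (\<exists>g\<in>H. H = range (\<lambda>k::int. g [^] k))"
    unfolding H.cyclic_group using int_pow_consistent[OF H] by simp
  also have "\<dots> \<longleftrightarrow> (\<exists>g\<in>H. H = generate G {g})"
    using generate_pow sub by (intro bex_cong) (auto simp: full_SetCompr_eq)
  also have "\<dots> \<longleftrightarrow> cyclic_over (subgroups G) H"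
    unfolding cyclic_over_def
  proof (intro bex_cong refl iffI ballI impI)
    fix g K assume "g \<in> H" "H = generate G {g}" "K \<in> subgroups G" "g \<in> K"
    then show "H \<subseteq> K"
      using generate_subgroup_incl[of "{g}" K] by (simp add: subgroups_def)
  next
    fix g assume g: "g \<in> H" "\<forall>K\<in>subgroups G. g \<in> K \<longrightarrow> H \<subseteq> K"
    have "generate G {g} \<in> subgroups G" "g \<in> generate G {g}"
      using g sub generate_is_subgroup[of "{g}"] by (auto simp: subgroups_def intro: generate.incl)
    then have "H \<subseteq> generate G {g}" using g by blast
    moreover have "generate G {g} \<subseteq> H"
      using generate_subgroup_incl[of "{g}" H] g H by simp
    ultimately show "H = generate G {g}" by blast
  qed
  finally show ?thesis .
qed

section \<open>Arithmetic of the products of a power of y and a power of x\<close>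

locale modular_relations = group G + prime_power_periods p m
  for G (structure) and p m +
  fixes x y
  assumes x_closed [simp]: "x \<in> carrier G" and y_closed [simp]: "y \<in> carrier G"
    and m_ge_2: "m \<ge> 2" and m_ge_3: "p = 2 \<Longrightarrow> m \<ge> 3"
    and conj_x: "x \<otimes> y = y \<otimes> x [^] (1 + p ^ (m - 1))"
    and elt_eq_one: "\<And>(b :: int) (a :: int). y [^] b \<otimes> x [^] a = \<one> \<longleftrightarrow> p dvd b \<and> p ^ m dvd a"
begin

abbreviation r :: int where "r \<equiv> p ^ (m - 1)"

definition elt :: "int \<Rightarrow> int \<Rightarrow> 'a" where
  "elt b a = y [^] b \<otimes> x [^] a"

definition exponents :: "'a set \<Rightarrow> (int \<times> int) set" where
  "exponents H = {(b, a). elt b a \<in> H}"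

definition elements :: "(int \<times> int) set \<Rightarrow> 'a set" where
  "elements L = (\<lambda>(b, a). elt b a) ` L"

lemma elt_closed [simp]: "elt b a \<in> carrier G"
  by (simp add: elt_def)

lemma p_r: "p * r = p ^ m"
  using m_ge_2 by (cases m) auto

lemma dvd_r_square: "p ^ m dvd r * r"
  using m_ge_2 by (auto simp flip: power_add intro!: le_imp_power_dvd)

lemma x_pow_eq: "p ^ m dvd a - c \<Longrightarrow> x [^] a = x [^] c"
  using elt_eq_one[of 0 "p ^ m"] by (intro int_pow_eqI[of x "p ^ m"]) auto

lemma y_pow_eq: "p dvd b - d \<Longrightarrow> y [^] b = y [^] d"
  using elt_eq_one[of p 0] by (intro int_pow_eqI[of y p]) auto

lemma elt_cong: "p dvd b - d \<Longrightarrow> p ^ m dvd a - c \<Longrightarrow> elt b a = elt d c"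
  unfolding elt_def using x_pow_eq y_pow_eq by presburger

text \<open>Moving \<open>x\<close> past \<open>y\<close> multiplies its exponent by
  \<open>1 + r\<close>. Since \<open>p ^ m\<close> divides \<open>r * r\<close>, the
  \<open>d\<close>-th power of \<open>1 + r\<close> is congruent to
  \<open>1 + d * r\<close>.\<close>

lemma x_y_commute_nat: "x [^] a \<otimes> y [^] int d = y [^] int d \<otimes> x [^] (a * (1 + int d * r))"
proof (induction d arbitrary: a)
  case 0
  show ?case by simp
next
  case (Suc d)
  have y: "y [^] int (Suc d) = y \<otimes> y [^] int d"
    using int_pow_mult[of y 1 "int d"] by (simp add: add.commute)
  have "x [^] a \<otimes> y = y \<otimes> x [^] (a * (1 + r))"
    using int_pow_push[OF _ _ _ conj_x, of a] by (simp add: int_pow_pow mult.commute)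
  then have "x [^] a \<otimes> y [^] int (Suc d) = y \<otimes> (x [^] (a * (1 + r)) \<otimes> y [^] int d)"
    unfolding y by (simp flip: m_assoc)
  also have "\<dots> = y [^] int (Suc d) \<otimes> x [^] (a * (1 + r) * (1 + int d * r))"
    unfolding Suc y by (simp add: m_assoc)
  also have "x [^] (a * (1 + r) * (1 + int d * r)) = x [^] (a * (1 + int (Suc d) * r))"
    using dvd_mult[OF dvd_r_square, of "a * int d"]
    by (intro x_pow_eq) (simp add: algebra_simps)
  finally show ?case .
qed

text \<open>Both sides depend only on \<open>d\<close> modulo \<open>p\<close>, because
  \<open>y\<close> has order \<open>p\<close> and \<open>p * r = p ^ m\<close>; this reduces to a
  natural exponent.\<close>

lemma x_y_commute: "x [^] a \<otimes> y [^] d = y [^] d \<otimes> x [^] (a * (1 + d * r))"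
proof -
  define k where "k = nat (d mod p)"
  have k: "int k = d mod p" using p_gt_1 by (simp add: k_def)
  have "y [^] d = y [^] int k"
    by (rule y_pow_eq) (simp add: k minus_mod_eq_mult_div)
  moreover have "x [^] (a * (1 + int k * r)) = x [^] (a * (1 + d * r))"
  proof (rule x_pow_eq)
    have "a * (1 + int k * r) - a * (1 + d * r) = - a * (d - d mod p) * r"
      unfolding k by (simp add: algebra_simps)
    also have "\<dots> = (p * r) * (- a * (d div p))"
      by (simp add: minus_mod_eq_mult_div)
    finally show "p ^ m dvd a * (1 + int k * r) - a * (1 + d * r)"
      unfolding p_r by simp
  qed
  ultimately show ?thesis
    using x_y_commute_nat[of a k] by simp
qed

lemma elt_mult: "elt b a \<otimes> elt d c = elt (b + d) (a + c + a * d * r)"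
proof -
  have "elt b a \<otimes> elt d c = y [^] b \<otimes> (x [^] a \<otimes> y [^] d) \<otimes> x [^] c"
    by (simp add: elt_def m_assoc)
  also have "\<dots> = y [^] b \<otimes> y [^] d \<otimes> (x [^] (a * (1 + d * r)) \<otimes> x [^] c)"
    by (simp add: x_y_commute m_assoc)
  also have "\<dots> = elt (b + d) (a * (1 + d * r) + c)"
    by (simp add: elt_def int_pow_mult)
  finally show ?thesis by (simp add: algebra_simps)
qed

lemma elt_zero: "elt 0 0 = \<one>"
  by (simp add: elt_def)

lemma elt_inv: "inv (elt b a) = elt (- b) (- a + a * b * r)"
proof -
  have "elt b a \<otimes> elt (- b) (- a + a * b * r) = \<one>"
    by (simp add: elt_mult elt_zero)
  then show ?thesis
    by (metis elt_closed inv_equality inv_inv)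
qed

lemma elt_eqD:
  assumes "elt b a = elt d c"
  shows "p dvd b - d" "p ^ m dvd a - c"
proof -
  have "\<one> = elt b a \<otimes> inv (elt d c)"
    using assms by simp
  also have "\<dots> = elt (b - d) (a - c + (c - a) * d * r)"
    by (simp add: elt_inv elt_mult algebra_simps)
  finally have *: "p dvd b - d" "p ^ m dvd a - c + (c - a) * d * r"
    using elt_eq_one[of "b - d"] by (auto simp: elt_def)
  then show "p dvd b - d" by simp
  \<comment> \<open>Modulo \<open>p ^ m\<close> the factor \<open>1 + d * r\<close> is inverse to
    \<open>1 - d * r\<close>, since \<open>r * r\<close> vanishes.\<close>
  have "p ^ m dvd (a - c + (c - a) * d * r) * (1 + d * r)"
    using *(2) by simp
  also have "(a - c + (c - a) * d * r) * (1 + d * r) = (a - c) - (a - c) * d * d * (r * r)"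
    by (simp add: algebra_simps)
  finally show "p ^ m dvd a - c"
    using dvd_add[OF _ dvd_mult[OF dvd_r_square, of "(a - c) * d * d"]]
    by (metis diff_add_cancel)
qed

text \<open>Modulo \<open>r\<close> the exponent of \<open>x\<close> after \<open>k\<close> factors
  is \<open>k * a\<close>, so the next factor adds the twist \<open>k * a * b * r\<close>, up to
  terms in \<open>r * r\<close>. The sum is the binomial coefficient of \<open>k\<close> over 2,
  kept undivided.\<close>

lemma elt_pow: "elt b a [^] (k :: nat) = elt (int k * b) (int k * a + a * b * r * (\<Sum>i<k. int i))"
proof (induction k)
  case 0
  show ?case by (simp add: elt_zero)
next
  case (Suc k)
  let ?s = "\<Sum>i<k. int i"
  have "elt b a [^] Suc k = elt (int k * b + b)
    (int k * a + a * b * r * ?s + a + (int k * a + a * b * r * ?s) * b * r)"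
    by (simp add: Suc elt_mult)
  also have "\<dots> = elt (int (Suc k) * b) (int (Suc k) * a + a * b * r * (\<Sum>i<Suc k. int i))"
    using dvd_mult[OF dvd_r_square, of "a * b * b * ?s"]
    by (intro elt_cong) (simp_all add: algebra_simps)
  finally show ?case .
qed

text \<open>For odd \<open>p\<close> the sum \<open>p * (p - 1) / 2\<close> is a multiple of
  \<open>p\<close>. For \<open>p = 2\<close> the sum is 1, and the factor 2 comes from
  \<open>p ^ (m - 2)\<close> with \<open>m\<close> at least 3.\<close>

lemma p_dvd_sum: "p dvd p ^ (m - 2) * (\<Sum>i<nat p. int i)"
proof (cases "p = 2")
  case True
  then show ?thesis
    using m_ge_3 by (intro dvd_mult2) (auto intro!: dvd_power)
next
  case False
  have "2 * (\<Sum>i<k. int i) = int k * (int k - 1)" for k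
    by (induction k) (auto simp: algebra_simps)
  from this[of "nat p"] have "p dvd 2 * (\<Sum>i<nat p. int i)"
    using p_gt_1 by simp
  moreover have "\<not> p dvd 2"
    using False p_gt_1 zdvd_imp_le[of p 2] by auto
  ultimately show ?thesis
    using prime_p prime_dvd_multD by (metis dvd_mult)
qed

lemma elt_snd_dvd:
  assumes "subgroup H G" "elt 0 a \<in> H" "a dvd c"
  shows "elt 0 c \<in> H"
proof -
  obtain k where "c = a * k" using assms(3) by blast
  then have "elt 0 c = elt 0 a [^] k"
    by (simp add: elt_def int_pow_pow)
  then show ?thesis
    using assms subgroup_int_pow_closed by metis
qed

lemma elt_zero_dvd: "p ^ m dvd a \<Longrightarrow> elt 0 a = \<one>"
  using elt_cong[of 0 0 a 0] by (simp add: elt_zero)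

text \<open>
  For \<open>a\<close> prime to \<open>p\<close>, the \<open>p\<close>-th power of \<open>y\<^sup>b x\<^sup>a\<close> is a power of \<open>x\<close> of order \<open>p\<^sup>m\<^sup>-\<^sup>1\<close>.
  For \<open>p = 2\<close> this fails in the dihedral group of order 8, where \<open>m = 2\<close>.
\<close>

lemma commutator_mem:
  assumes H: "subgroup H G" and "elt b a \<in> H"
  shows "elt 0 (a * d * r) \<in> H"
proof (cases "p dvd a")
  case True
  then have "p * r dvd a * d * r" by simp
  then show ?thesis
    unfolding p_r using H by (simp add: elt_zero_dvd subgroup.one_closed)
next
  case False
  define s where "s = (\<Sum>i<nat p. int i)"
  obtain l where l: "p ^ (m - 2) * s = p * l"
    using p_dvd_sum by (auto simp: s_def)
  have r: "r = p * p ^ (m - 2)"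
    using m_ge_2 power_Suc[of p "m - 2"] by (simp add: Suc_diff_Suc numeral_2_eq_2)
  \<comment> \<open>Chosen so that the \<open>p\<close>-th power of \<open>elt b a\<close> is
    \<open>elt 0 (p * t)\<close>. It is congruent to \<open>a\<close> modulo \<open>p\<close>, hence
    prime to \<open>p\<close>.\<close>
  define t where "t = a * (1 + b * (p * l))"
  have t: "\<not> p dvd t"
  proof
    assume "p dvd t"
    then have "p dvd t - a * b * l * p" by simp
    also have "t - a * b * l * p = a" by (simp add: t_def algebra_simps)
    finally show False using False by simp
  qed
  have "elt b a [^] nat p = elt (p * b) (p * a + a * b * r * s)"
    using p_gt_1 by (simp add: elt_pow s_def)
  also have "\<dots> = elt 0 (p * t)"
  proof (rule elt_cong)
    have "p * a + a * b * r * s = p * a + a * b * p * (p ^ (m - 2) * s)"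
      unfolding r by (simp add: mult_ac)
    also have "\<dots> = p * t"
      unfolding l by (simp add: t_def algebra_simps)
    finally show "p ^ m dvd p * a + a * b * r * s - p * t"
      by simp
  qed simp
  finally have pt: "elt 0 (p * t) \<in> H"
    using subgroup_int_pow_closed[OF assms, of "int (nat p)"] by (simp only: int_pow_int)
  \<comment> \<open>Bezout turns \<open>elt 0 (p * t)\<close> into \<open>elt 0 p\<close>, and
    \<open>a * d * r\<close> is a multiple of \<open>p\<close>.\<close>
  obtain u v where "u * (p * t) + v * p ^ m = gcd (p * t) (p ^ m)"
    using bezout_int by blast
  also have "\<dots> = p"
    using gcd_power_mult[OF t, of 1] m_ge_2 by simp
  finally have uv: "u * (p * t) + v * p ^ m = p" .
  have "elt 0 p = elt 0 (u * (p * t))"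
  proof (rule elt_cong)
    have "p - u * (p * t) = v * p ^ m" using uv by simp
    then show "p ^ m dvd p - u * (p * t)" by simp
  qed simp
  then have "elt 0 p \<in> H"
    using elt_snd_dvd[OF H pt, of "u * (p * t)"] by simp
  then show ?thesis
    by (rule elt_snd_dvd[OF H]) (unfold r, simp)
qed

section \<open>Correspondence between subgroups and lattices\<close>

lemma exponents_mem:
  assumes H: "subgroup H G"
  shows "exponents H \<in> \<Lambda>"
proof -
  have "elt (b - d) (a - c) \<in> H" if ba: "elt b a \<in> H" and dc: "elt d c \<in> H" for b a d c
  proof -
    \<comment> \<open>The quotient has second exponent \<open>a - c + (c - a) * d * r\<close>; the
      last two factors cancel the twist.\<close>
    have "elt b a \<otimes> inv (elt d c) \<otimes> (elt 0 (a * d * r) \<otimes> inv (elt 0 (c * d * r))) \<in> H"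
      using H that commutator_mem[OF H] by (intro subgroup.m_closed subgroup.m_inv_closed)
    also have "elt b a \<otimes> inv (elt d c) \<otimes> (elt 0 (a * d * r) \<otimes> inv (elt 0 (c * d * r)))
        = elt (b - d) (a - c)"
      by (simp add: elt_inv elt_mult algebra_simps)
    finally show ?thesis .
  qed
  moreover have "elt p 0 = \<one>" "elt 0 (p ^ m) = \<one>"
    by (simp_all only: elt_def elt_eq_one) simp_all
  ultimately show ?thesis
    using subgroup.one_closed[OF H] by (auto simp: period_lattices_def exponents_def)
qed

text \<open>The counterpart of \<open>commutator_mem\<close>: \<open>p\<close> times
  \<open>(b, a)\<close> minus \<open>(p * b, 0)\<close> is \<open>(0, p * a)\<close>. For
  \<open>a\<close> prime to \<open>p\<close> this gives \<open>(0, p)\<close>, and \<open>p\<close>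
  divides \<open>r\<close>.\<close>

lemma lattice_commutator:
  assumes L: "L \<in> \<Lambda>" and ba: "(b, a) \<in> L"
  shows "(0, a * d * r) \<in> L"
proof (cases "p dvd a")
  case True
  then have "p * r dvd a * d * r" by simp
  then show ?thesis
    using period_lattices_snd_dvd[OF L, of "p ^ m"] L unfolding p_r by (simp add: period_lattices_def)
next
  case False
  have "(p * b - p * b, p * a - 0) \<in> L"
    using period_lattices_scale[OF L ba] period_lattices_fst[OF L, of "p * b"]
    by (intro period_lattices_diff[OF L]) auto
  then have "(0, p) \<in> L"
    using power_in_lattice[OF L, of 1 a] False m_ge_2 by simp
  moreover have "p dvd r"
    using m_ge_2 by (intro dvd_power) auto
  ultimately show ?thesis
    using period_lattices_snd_dvd[OF L] by simp
qed

lemma elements_subgroup: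
  assumes L: "L \<in> \<Lambda>"
  shows "subgroup (elements L) G"
proof (rule subgroupI)
  show "elements L \<subseteq> carrier G"
    by (auto simp: elements_def)
  show "elements L \<noteq> {}"
    using period_lattices_zero[OF L] by (auto simp: elements_def)
next
  fix g assume "g \<in> elements L"
  then obtain b a where g: "g = elt b a" "(b, a) \<in> L" by (auto simp: elements_def)
  have "(- b + 0, - a + a * b * r) \<in> L"
    using g lattice_commutator[OF L]
    by (intro period_lattices_add[OF L] period_lattices_uminus[OF L])
  then show "inv g \<in> elements L"
    by (force simp: g elt_inv elements_def)
next
  fix g h assume "g \<in> elements L" "h \<in> elements L"
  then obtain b a d c where g: "g = elt b a" "(b, a) \<in> L" and h: "h = elt d c" "(d, c) \<in> L"
    by (auto simp: elements_def)
  have "(b + d + 0, a + c + a * d * r) \<in> L"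
    using g h lattice_commutator[OF L] by (intro period_lattices_add[OF L])
  then show "g \<otimes> h \<in> elements L"
    by (force simp: g h elt_mult elements_def)
qed

text \<open>Pairs naming the same element differ by multiples of \<open>p\<close> and of
  \<open>p ^ m\<close>, and these periods belong to \<open>L\<close>.\<close>

lemma exponents_elements:
  assumes L: "L \<in> \<Lambda>"
  shows "exponents (elements L) = L"
proof -
  have mem: "(b, a) \<in> L" if "elt b a = elt d c" "(d, c) \<in> L" for b a d c
  proof -
    have "(0, a - c) \<in> L"
      using period_lattices_snd_dvd[OF L _ elt_eqD(2)[OF that(1)]] L by (simp add: period_lattices_def)
    from period_lattices_add[OF L period_lattices_add[OF L that(2) this]
        period_lattices_fst[OF L elt_eqD(1)[OF that(1)]]]
    show ?thesis by simp
  qed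
  show ?thesis
  proof
    show "L \<subseteq> exponents (elements L)"
      by (force simp: exponents_def elements_def)
    show "exponents (elements L) \<subseteq> L"
    proof (rule subrelI)
      fix b a assume "(b, a) \<in> exponents (elements L)"
      then obtain v where "v \<in> L" "elt b a = (case v of (d, c) \<Rightarrow> elt d c)"
        unfolding exponents_def elements_def by blast
      then show "(b, a) \<in> L"
        by (cases v) (simp add: mem)
    qed
  qed
qed

end

text \<open>Generation is split off from \<open>modular_relations\<close> because, for the presented
  group, it is derived from the product and inverse formulas proved there.\<close>

locale modular_group = modular_relations +
  assumes carrier_eq: "\<And>g. g \<in> carrier G \<Longrightarrow> \<exists>b a. g = elt b a"
begin

lemma elements_exponents:
  assumes "H \<subseteq> carrier G"
  shows "elements (exponents H) = H"
proof
  show "elements (exponents H) \<subseteq> H"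
    by (auto simp: exponents_def elements_def)
  show "H \<subseteq> elements (exponents H)"
  proof
    fix g assume g: "g \<in> H"
    then obtain b a where "g = elt b a"
      using carrier_eq[of g] assms by auto
    with g show "g \<in> elements (exponents H)"
      by (auto simp: exponents_def elements_def)
  qed
qed

lemma bij_elements: "bij_betw elements \<Lambda> (subgroups G)"
proof (rule bij_betw_byWitness[where f' = exponents])
  show "\<forall>L\<in>\<Lambda>. exponents (elements L) = L"
    using exponents_elements by blast
  show "\<forall>H\<in>subgroups G. elements (exponents H) = H"
    using elements_exponents subgroup.subset unfolding subgroups_def by blast
  show "elements ` \<Lambda> \<subseteq> subgroups G"
    using elements_subgroup unfolding subgroups_def by blast
  show "exponents ` subgroups G \<subseteq> \<Lambda>"
    using exponents_mem unfolding subgroups_def by blast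
qed

text \<open>Both \<open>elements\<close> and \<open>exponents\<close> preserve inclusion, so
  \<open>(b, a)\<close> generates \<open>L\<close> exactly when \<open>elt b a\<close> generates
  \<open>elements L\<close>.\<close>

lemma cyclic_over_elements:
  assumes L: "L \<in> \<Lambda>"
  shows "cyclic_over (subgroups G) (elements L) \<longleftrightarrow> cyclic_over \<Lambda> L"
proof
  assume "cyclic_over (subgroups G) (elements L)"
  then obtain b a where ba: "(b, a) \<in> L"
    and gen: "\<And>H. subgroup H G \<Longrightarrow> elt b a \<in> H \<Longrightarrow> elements L \<subseteq> H"
    by (auto simp: cyclic_over_def subgroups_def elements_def)
  have "L \<subseteq> L'" if L': "L' \<in> \<Lambda>" "(b, a) \<in> L'" for L'
  proof -
    have "elements L \<subseteq> elements L'"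
      using L' by (intro gen elements_subgroup) (auto simp: elements_def)
    then have "exponents (elements L) \<subseteq> exponents (elements L')"
      by (auto simp: exponents_def)
    then show ?thesis
      using L L' exponents_elements by simp
  qed
  then show "cyclic_over \<Lambda> L"
    using ba unfolding cyclic_over_def by blast
next
  assume "cyclic_over \<Lambda> L"
  then obtain b a where ba: "(b, a) \<in> L"
    and gen: "\<And>L'. L' \<in> \<Lambda> \<Longrightarrow> (b, a) \<in> L' \<Longrightarrow> L \<subseteq> L'"
    unfolding cyclic_over_def by auto
  have "elements L \<subseteq> H" if H: "subgroup H G" "elt b a \<in> H" for H
  proof -
    have "L \<subseteq> exponents H"
      using H by (intro gen exponents_mem) (auto simp: exponents_def)
    then show ?thesis
      by (auto simp: exponents_def elements_def)
  qed
  moreover have "elt b a \<in> elements L"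
    using ba by (force simp: elements_def)
  ultimately show "cyclic_over (subgroups G) (elements L)"
    unfolding cyclic_over_def subgroups_def by (intro bexI[of _ "elt b a"]) simp_all
qed

lemma card_subgroups: "card (subgroups G) = m + 2 + m * nat p"
  using bij_betw_same_card[OF bij_elements] card_lattices by simp

lemma card_cyclic_subgroups: "card (cyclic_subgroups G) = m * nat p + 2"
proof -
  have "cyclic_subgroups G = {H \<in> subgroups G. cyclic_over (subgroups G) H}"
    using cyclic_subgroup_iff by (auto simp: cyclic_subgroups_def subgroups_def)
  also have "\<dots> = {H \<in> elements ` \<Lambda>. cyclic_over (subgroups G) H}"
    using bij_elements by (simp add: bij_betw_def)
  also have "\<dots> = elements ` {L \<in> \<Lambda>. cyclic_over \<Lambda> L}"
    using cyclic_over_elements by auto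
  finally have "cyclic_subgroups G = elements ` {L \<in> \<Lambda>. cyclic_over \<Lambda> L}" .
  moreover have "inj_on elements {L \<in> \<Lambda>. cyclic_over \<Lambda> L}"
    using bij_elements by (auto simp: bij_betw_def intro: inj_on_subset)
  ultimately show ?thesis
    using card_cyclic_lattices by (simp add: card_image)
qed

end

section \<open>The presented group\<close>

definition word_eval :: "('k, 'm) monoid_scheme \<Rightarrow> ('a \<Rightarrow> 'k) \<Rightarrow> 'a word \<Rightarrow> 'k" where
  "word_eval K f w =
     foldr (\<lambda>(a, b) z. (if b then f a else inv\<^bsub>K\<^esub> f a) \<otimes>\<^bsub>K\<^esub> z) w \<one>\<^bsub>K\<^esub>"

text \<open>The homomorphism given by the universal property; \<open>word_eval_cong\<close> makes
  the chosen representative irrelevant.\<close>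

definition free_lift :: "('k, 'm) monoid_scheme \<Rightarrow> ('a \<Rightarrow> 'k) \<Rightarrow> 'a word set \<Rightarrow> 'k" where
  "free_lift K f A = word_eval K f (SOME w. w \<in> A)"

context group
begin

lemma word_eval_closed:
  assumes "\<And>a. f a \<in> carrier G"
  shows "word_eval G f w \<in> carrier G"
  by (induction w) (auto simp: word_eval_def assms)

lemma word_eval_append:
  assumes "\<And>a. f a \<in> carrier G"
  shows "word_eval G f (u @ v) = word_eval G f u \<otimes> word_eval G f v"
proof (induction u)
  case Nil
  show ?case using word_eval_closed[of f, OF assms, of v] by (simp add: word_eval_def)
next
  case (Cons z u)
  obtain a b where "z = (a, b)" by fastforce
  then show ?case
    using Cons.IH word_eval_closed[of f, OF assms, of u] word_eval_closed[of f, OF assms, of v] assms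
    by (simp add: word_eval_def m_assoc)
qed

lemma word_eval_cong:
  assumes f: "\<And>a. f a \<in> carrier G" and "(u, v) \<in> word_eq"
  shows "word_eval G f u = word_eval G f v"
proof -
  have step: "word_eval G f s = word_eval G f t" if st: "cancel_step s t" for s t
  proof -
    obtain us a b vs where s: "s = us @ [(a, b), (a, \<not> b)] @ vs" and t: "t = us @ vs"
      using st unfolding cancel_step_def by blast
    have "word_eval G f [(a, b), (a, \<not> b)] = \<one>"
      using f by (simp add: word_eval_def)
    then show ?thesis
      unfolding s t word_eval_append[of f, OF f] using word_eval_closed[of f, OF f] by simp
  qed
  have "equivclp cancel_step u v"
    using assms(2) by (simp add: word_eq_def)
  then show ?thesis
    by (induction rule: equivclp_induct) (use step in auto)
qed

lemma free_lift_class: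
  assumes f: "\<And>a. f a \<in> carrier G"
  shows "free_lift G f (word_eq `` {w}) = word_eval G f w"
proof -
  have "w \<in> word_eq `` {w}"
    by (simp add: word_eq_def)
  then have "(SOME v. v \<in> word_eq `` {w}) \<in> word_eq `` {w}"
    by (rule someI)
  then show ?thesis
    using word_eval_cong[of f, OF f] by (force simp: free_lift_def)
qed

lemma free_lift_hom:
  fixes f :: "'c \<Rightarrow> 'a"
  assumes f: "\<And>a. f a \<in> carrier G"
  shows "free_lift G f \<in> hom free_group G"
proof (rule homI)
  fix A :: "'c word set" assume "A \<in> carrier free_group"
  then obtain u where A: "A = word_eq `` {u}"
    by (auto simp: free_group_def elim: quotientE)
  show "free_lift G f A \<in> carrier G"
    by (simp add: A free_lift_class[of f, OF f] word_eval_closed[of f, OF f])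
  fix B :: "'c word set" assume "B \<in> carrier free_group"
  then obtain v where B: "B = word_eq `` {v}"
    by (auto simp: free_group_def elim: quotientE)
  show "free_lift G f (A \<otimes>\<^bsub>free_group\<^esub> B) = free_lift G f A \<otimes> free_lift G f B"
    by (simp add: A B free_group_mult_class free_lift_class[of f, OF f] word_eval_append[of f, OF f])
qed

lemma free_lift_gen:
  assumes "\<And>a. f a \<in> carrier G"
  shows "free_lift G f (free_gen a) = f a"
  using assms free_lift_class[of f] by (simp add: free_gen_def word_eval_def)

text \<open>The kernel is a normal subgroup containing \<open>R\<close>. This is the content of von
  Dyck's theorem.\<close>

lemma normal_closure_subset_kernel:
  assumes "R \<subseteq> carrier G" "group K" "h \<in> hom G K" "\<And>g. g \<in> R \<Longrightarrow> h g = \<one>\<^bsub>K\<^esub>"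
  shows "normal_closure G R \<subseteq> kernel G K h"
proof -
  interpret h: group_hom G K h
    using assms is_group by (simp add: group_hom_def group_hom_axioms_def)
  show ?thesis
    unfolding normal_closure_def using assms h.normal_kernel
    by (intro hull_minimal) (auto simp: kernel_def)
qed

end

text \<open>By induction on the word, each class is a product of generators and their inverses, a
  letter with sign \<open>False\<close> being the inverse of its generator.\<close>

lemma free_group_generated:
  assumes H: "subgroup H free_group" and gen: "\<And>a. free_gen a \<in> H"
  shows "H = carrier free_group"
proof -
  interpret F: group free_group by (rule group_free_group)
  have "word_eq `` {w} \<in> H" for w
  proof (induction w)
    case Nil
    show ?case
      using subgroup.one_closed[OF H] by (simp add: free_group_def)
  next
    case (Cons z w)
    obtain a b where z: "z = (a, b)" by fastforce
    have "word_eq `` {[(a, False)]} \<otimes>\<^bsub>free_group\<^esub> free_gen a = \<one>\<^bsub>free_group\<^esub>"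
    proof -
      have "cancel_step [(a, False), (a, True)] []"
        unfolding cancel_step_def by force
      then have "([(a, False), (a, True)], []) \<in> word_eq"
        by (auto simp: word_eq_def)
      then show ?thesis
        by (simp add: free_gen_def free_group_mult_class equiv_class_eq[OF equiv_word_eq])
          (simp add: free_group_def)
    qed
    moreover have "word_eq `` {[(a, False)]} \<in> carrier free_group"
      by (simp add: free_group_def quotientI)
    ultimately have "word_eq `` {[(a, False)]} = inv\<^bsub>free_group\<^esub> free_gen a"
      using F.inv_equality free_gen_closed by metis
    then have "word_eq `` {[z]} \<in> H"
      using gen[of a] subgroup.m_inv_closed[OF H gen[of a]]
      by (cases b) (simp_all add: z free_gen_def)
    then have "word_eq `` {[z]} \<otimes>\<^bsub>free_group\<^esub> word_eq `` {w} \<in> H"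
      using Cons H by (simp add: subgroup.m_closed)
    then show ?case by (simp add: free_group_mult_class)
  qed
  moreover have "A \<in> H" if "A \<in> carrier free_group" for A
    using that calculation by (auto simp: free_group_def elim: quotientE)
  ultimately show ?thesis
    using subgroup.subset[OF H] by blast
qed

text \<open>
  The pair \<open>(b, a)\<close> stands for \<open>y\<^sup>b x\<^sup>a\<close>; the model bounds the order of the presented group
  from below.
\<close>

definition modular_model :: "int \<Rightarrow> int \<Rightarrow> int \<Rightarrow> (int \<times> int) monoid" where
  "modular_model p q r =
     \<lparr>carrier = {0..<p} \<times> {0..<q},
      monoid.mult = (\<lambda>(b, a) (d, c). ((b + d) mod p, (a + c + a * d * r) mod q)),
      monoid.one = (0, 0)\<rparr>"

section \<open>The model group and normal forms in the presented group\<close>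

locale modular_parameters =
  fixes p q r :: int
  assumes p_pos: "p > 1" and q_pos: "q > 1" and p_r: "p * r = q" and q_dvd: "q dvd r * r"
begin

abbreviation "K \<equiv> modular_model p q r"

text \<open>Once every residue is written as a number minus a multiple of its modulus, the two sides
  differ by a combination of \<open>q\<close>, \<open>r * r\<close> and \<open>p * r\<close>, all
  multiples of \<open>q\<close>.\<close>

lemma mult_assoc_aux:
  "((a + c + a * d * r) mod q + e + ((a + c + a * d * r) mod q) * f * r) mod q
    = (a + (c + e + c * f * r) mod q + a * ((d + f) mod p) * r) mod q"
proof -
  obtain k where k: "(a + c + a * d * r) mod q = a + c + a * d * r - q * k"
    by (metis minus_mult_div_eq_mod)
  obtain l where l: "(c + e + c * f * r) mod q = c + e + c * f * r - q * l"
    by (metis minus_mult_div_eq_mod)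
  obtain j where j: "(d + f) mod p = d + f - p * j"
    by (metis minus_mult_div_eq_mod)
  obtain i where i: "r * r = q * i"
    using q_dvd by blast
  have "((a + c + a * d * r) mod q + e + ((a + c + a * d * r) mod q) * f * r)
      - (a + (c + e + c * f * r) mod q + a * ((d + f) mod p) * r)
      = a * d * f * (r * r) - q * (k + k * f * r - l) + a * j * (p * r)"
    unfolding k l j by (simp add: algebra_simps)
  also have "\<dots> = q * (a * d * f * i - (k + k * f * r - l) + a * j)"
    unfolding i p_r by (simp add: algebra_simps)
  finally show ?thesis
    by (simp add: mod_eq_dvd_iff)
qed

lemma group_K: "group K"
proof (rule groupI)
  fix g assume "g \<in> carrier K"
  then obtain b a where g: "g = (b, a)" "b \<in> {0..<p}" "a \<in> {0..<q}"
    by (auto simp: modular_model_def)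
  show "\<one>\<^bsub>K\<^esub> \<otimes>\<^bsub>K\<^esub> g = g"
    using g by (simp add: modular_model_def)
  \<comment> \<open>The inverse must solve \<open>A * (1 + b * r) = - a\<close> modulo
    \<open>q\<close>, and \<open>1 - b * r\<close> inverts \<open>1 + b * r\<close> there.\<close>
  define A where "A = (- a + a * b * r) mod q"
  obtain k where k: "A = - a + a * b * r - q * k"
    unfolding A_def by (metis minus_mult_div_eq_mod)
  obtain i where i: "r * r = q * i"
    using q_dvd by blast
  have "A + a + A * b * r = a * b * b * (r * r) - q * (k + k * b * r)"
    by (simp add: k algebra_simps)
  also have "\<dots> = q * (a * b * b * i - (k + k * b * r))"
    unfolding i by (simp add: algebra_simps)
  finally have "(A + a + A * b * r) mod q = 0"
    by simp
  then have "((- b) mod p, A) \<otimes>\<^bsub>K\<^esub> g = \<one>\<^bsub>K\<^esub>"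
    by (simp add: g modular_model_def mod_add_left_eq)
  moreover have "((- b) mod p, A) \<in> carrier K"
    using p_pos q_pos by (simp add: modular_model_def A_def)
  ultimately show "\<exists>h\<in>carrier K. h \<otimes>\<^bsub>K\<^esub> g = \<one>\<^bsub>K\<^esub>" by blast
next
  fix u v w :: "int \<times> int"
  obtain b a d c f e where "u = (b, a)" "v = (d, c)" "w = (f, e)"
    by fastforce
  then show "u \<otimes>\<^bsub>K\<^esub> v \<otimes>\<^bsub>K\<^esub> w = u \<otimes>\<^bsub>K\<^esub> (v \<otimes>\<^bsub>K\<^esub> w)"
    by (simp add: modular_model_def mult_assoc_aux mod_add_left_eq mod_add_right_eq)
      (simp add: add.assoc)
qed (use p_pos q_pos in \<open>auto simp: modular_model_def\<close>)

lemma x_pow: "(0, 1) [^]\<^bsub>K\<^esub> (k :: nat) = (0, int k mod q)"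
  using q_pos by (induction k) (simp_all add: modular_model_def mod_simps add.commute)

lemma y_pow: "(1, 0) [^]\<^bsub>K\<^esub> (k :: nat) = (int k mod p, 0)"
  using p_pos by (induction k) (simp_all add: modular_model_def mod_simps add.commute)

lemma mem: "(0, 1) \<in> carrier K" "(1, 0) \<in> carrier K"
  using p_pos q_pos by (auto simp: modular_model_def)

lemma conj_relation:
  assumes "r = int k"
  shows "(0, 1) \<otimes>\<^bsub>K\<^esub> (1, 0) = (1, 0) \<otimes>\<^bsub>K\<^esub> (0, 1) [^]\<^bsub>K\<^esub> (k + 1)"
  unfolding x_pow using p_pos q_pos by (simp add: assms modular_model_def add.commute)

lemma y_x_pow_eq_one:
  assumes "(1, 0) [^]\<^bsub>K\<^esub> (b :: int) \<otimes>\<^bsub>K\<^esub> (0, 1) [^]\<^bsub>K\<^esub> (a :: int) = \<one>\<^bsub>K\<^esub>"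
  shows "p dvd b \<and> q dvd a"
proof -
  interpret K: group K by (rule group_K)
  have y: "(1, 0) [^]\<^bsub>K\<^esub> b = (b mod p, 0)"
  proof -
    \<comment> \<open>Passing to the residue makes the exponent a natural number, to which
      \<open>y_pow\<close> applies.\<close>
    have "(1, 0) [^]\<^bsub>K\<^esub> b = (1, 0) [^]\<^bsub>K\<^esub> int (nat (b mod p))"
    proof (rule K.int_pow_eqI)
      show "(1, 0) [^]\<^bsub>K\<^esub> p = \<one>\<^bsub>K\<^esub>"
        using y_pow[of "nat p"] p_pos int_pow_int[of K "(1, 0)" "nat p"] by (simp add: modular_model_def)
      show "p dvd b - int (nat (b mod p))"
        using p_pos by (simp add: minus_mod_eq_mult_div)
    qed (rule mem)
    then show ?thesis
      unfolding int_pow_int y_pow using p_pos by simp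
  qed
  have x: "(0, 1) [^]\<^bsub>K\<^esub> a = (0, a mod q)"
  proof -
    have "(0, 1) [^]\<^bsub>K\<^esub> a = (0, 1) [^]\<^bsub>K\<^esub> int (nat (a mod q))"
    proof (rule K.int_pow_eqI)
      show "(0, 1) [^]\<^bsub>K\<^esub> q = \<one>\<^bsub>K\<^esub>"
        using x_pow[of "nat q"] q_pos int_pow_int[of K "(0, 1)" "nat q"] by (simp add: modular_model_def)
      show "q dvd a - int (nat (a mod q))"
        using q_pos by (simp add: minus_mod_eq_mult_div)
    qed (rule mem)
    then show ?thesis
      unfolding int_pow_int x_pow using q_pos by simp
  qed
  show ?thesis
    using assms unfolding x y by (auto simp: modular_model_def)
qed

end

text \<open>The defining relations hold in the quotient by construction. A homomorphism to the model
  shows that no further products of powers collapse, and the generators of the free group yield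
  normal forms for all elements.\<close>

lemma modular_group_M_group:
  fixes p n :: nat
  assumes prime: "Factorial_Ring.prime p" and n: "n \<ge> 3" and n4: "p = 2 \<Longrightarrow> n \<ge> 4"
  obtains x y where "modular_group (M_group p n) (int p) (n - 1) x y"
proof -
  define F :: "xy word set monoid" where "F = free_group"
  define q where "q = p ^ (n - 1)"
  define r where "r = p ^ (n - 2)"
  define gx where "gx = free_gen Gen_x"
  define gy where "gy = free_gen Gen_y"
  define R where "R = {gx [^]\<^bsub>F\<^esub> q, gy [^]\<^bsub>F\<^esub> p,
    inv\<^bsub>F\<^esub> gy \<otimes>\<^bsub>F\<^esub> gx \<otimes>\<^bsub>F\<^esub> gy \<otimes>\<^bsub>F\<^esub> inv\<^bsub>F\<^esub> (gx [^]\<^bsub>F\<^esub> (r + 1))}"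
  define N where "N = normal_closure F R"
  define M where "M = F Mod N"
  have M: "M_group p n = M"
    by (simp add: M_group_def Let_def presented_group_def M_def N_def R_def gx_def gy_def q_def r_def F_def)
  interpret F: group F unfolding F_def by (rule group_free_group)
  have gxy [simp]: "gx \<in> carrier F" "gy \<in> carrier F"
    by (simp_all add: gx_def gy_def F_def free_gen_closed)
  have R: "R \<subseteq> carrier F" by (simp add: R_def)
  interpret N: normal N F
    unfolding N_def using R by (rule F.normal_closure_normal)
  interpret M: group M unfolding M_def by (rule N.factorgroup_is_group)
  define \<pi> where "\<pi> = (\<lambda>g. N #>\<^bsub>F\<^esub> g)"
  interpret \<pi>: group_hom F M \<pi>
    unfolding group_hom_def group_hom_axioms_def \<pi>_def M_def
    using N.r_coset_hom_Mod N.factorgroup_is_group F.is_group by blast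
  have \<pi>_one: "\<pi> g = \<one>\<^bsub>M\<^esub> \<longleftrightarrow> g \<in> N" if "g \<in> carrier F" for g
    using that F.coset_join1[of N g] F.coset_join2[of g N] N.subgroup_axioms
    by (auto simp: \<pi>_def M_def FactGroup_def)
  have \<pi>_R: "\<pi> g = \<one>\<^bsub>M\<^esub>" if "g \<in> R" for g
    using that R \<pi>_one by (auto simp: N_def normal_closure_def intro: hull_inc)
  define x where "x = \<pi> gx"
  define y where "y = \<pi> gy"
  have xy [simp]: "x \<in> carrier M" "y \<in> carrier M"
    by (simp_all add: x_def y_def)
  have xq: "x [^]\<^bsub>M\<^esub> q = \<one>\<^bsub>M\<^esub>" and yp: "y [^]\<^bsub>M\<^esub> p = \<one>\<^bsub>M\<^esub>"
    using \<pi>_R[of "gx [^]\<^bsub>F\<^esub> q"] \<pi>_R[of "gy [^]\<^bsub>F\<^esub> p"]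
    by (simp_all add: R_def x_def y_def \<pi>.hom_nat_pow)
  have "inv\<^bsub>M\<^esub> y \<otimes>\<^bsub>M\<^esub> x \<otimes>\<^bsub>M\<^esub> y \<otimes>\<^bsub>M\<^esub> inv\<^bsub>M\<^esub> (x [^]\<^bsub>M\<^esub> (r + 1)) = \<one>\<^bsub>M\<^esub>"
    using \<pi>_R[of "inv\<^bsub>F\<^esub> gy \<otimes>\<^bsub>F\<^esub> gx \<otimes>\<^bsub>F\<^esub> gy \<otimes>\<^bsub>F\<^esub> inv\<^bsub>F\<^esub> (gx [^]\<^bsub>F\<^esub> (r + 1))"]
    by (simp add: R_def x_def y_def \<pi>.hom_nat_pow del: nat_pow_Suc)
  then have "inv\<^bsub>M\<^esub> y \<otimes>\<^bsub>M\<^esub> (x \<otimes>\<^bsub>M\<^esub> y) = x [^]\<^bsub>M\<^esub> (r + 1)"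
    using M.inv_equality[of "inv\<^bsub>M\<^esub> y \<otimes>\<^bsub>M\<^esub> x \<otimes>\<^bsub>M\<^esub> y" "inv\<^bsub>M\<^esub> (x [^]\<^bsub>M\<^esub> (r + 1))"]
    by (simp add: M.m_assoc del: nat_pow_Suc)
  then have rel: "x \<otimes>\<^bsub>M\<^esub> y = y \<otimes>\<^bsub>M\<^esub> x [^]\<^bsub>M\<^esub> (r + 1)"
    by (metis M.inv_solve_left M.m_closed M.nat_pow_closed xy)

  have p1: "p > 1" using prime by (rule prime_gt_1_nat)
  have pr: "p * r = q"
    using n by (simp add: q_def r_def flip: power_Suc) (simp add: Suc_diff_Suc numeral_2_eq_2)
  have qr: "q dvd r * r"
    using n by (simp add: q_def r_def le_imp_power_dvd flip: power_add)
  have q1: "q > 1" unfolding q_def using p1 n by (intro one_less_power) auto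
  interpret K: modular_parameters "int p" "int q" "int r"
    using p1 q1 pr qr by unfold_locales (simp_all flip: of_nat_mult)
  let ?K = "modular_model (int p) (int q) (int r)"
  interpret GK: group ?K by (rule K.group_K)
  define f where "f = (\<lambda>g. case g of Gen_x \<Rightarrow> (0 :: int, 1 :: int) | Gen_y \<Rightarrow> (1, 0))"
  have f: "f g \<in> carrier ?K" for g
    by (cases g) (simp_all add: f_def K.mem)
  define h where "h = free_lift ?K f"
  interpret h: group_hom F ?K h
    unfolding group_hom_def group_hom_axioms_def h_def
    using GK.free_lift_hom[of f, OF f] F.is_group GK.is_group by (simp add: F_def)
  have hx: "h gx = (0, 1)" and hy: "h gy = (1, 0)"
    using GK.free_lift_gen[of f, OF f] by (simp_all add: h_def gx_def gy_def f_def)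
  have hR: "h g = \<one>\<^bsub>?K\<^esub>" if "g \<in> R" for g
  proof -
    have 1: "h (gx [^]\<^bsub>F\<^esub> q) = \<one>\<^bsub>?K\<^esub>" "h (gy [^]\<^bsub>F\<^esub> p) = \<one>\<^bsub>?K\<^esub>"
      by (simp_all add: h.hom_nat_pow hx hy K.x_pow K.y_pow) (simp_all add: modular_model_def)
    have "inv\<^bsub>?K\<^esub> (1, 0) \<otimes>\<^bsub>?K\<^esub> ((0, 1) \<otimes>\<^bsub>?K\<^esub> (1, 0)) = (0, 1) [^]\<^bsub>?K\<^esub> (r + 1)"
      unfolding K.conj_relation[OF refl] using K.mem by (simp del: nat_pow_Suc flip: GK.m_assoc)
    then have "h (inv\<^bsub>F\<^esub> gy \<otimes>\<^bsub>F\<^esub> gx \<otimes>\<^bsub>F\<^esub> gy \<otimes>\<^bsub>F\<^esub> inv\<^bsub>F\<^esub> (gx [^]\<^bsub>F\<^esub> (r + 1))) = \<one>\<^bsub>?K\<^esub>"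
      using K.mem by (simp add: h.hom_nat_pow hx hy GK.m_assoc del: nat_pow_Suc)
    with 1 that show ?thesis by (auto simp: R_def)
  qed
  \<comment> \<open>Whatever becomes trivial in the presented group is trivial in the model.\<close>
  have kernel: "h g = \<one>\<^bsub>?K\<^esub>" if "g \<in> N" for g
    using F.normal_closure_subset_kernel[OF R GK.is_group h.homh hR] that
    by (auto simp: N_def kernel_def)

  have eq_one: "y [^]\<^bsub>M\<^esub> b \<otimes>\<^bsub>M\<^esub> x [^]\<^bsub>M\<^esub> a = \<one>\<^bsub>M\<^esub> \<longleftrightarrow> int p dvd b \<and> int q dvd a" for a b :: int
  proof
    assume "y [^]\<^bsub>M\<^esub> b \<otimes>\<^bsub>M\<^esub> x [^]\<^bsub>M\<^esub> a = \<one>\<^bsub>M\<^esub>"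
    then have "\<pi> (gy [^]\<^bsub>F\<^esub> b \<otimes>\<^bsub>F\<^esub> gx [^]\<^bsub>F\<^esub> a) = \<one>\<^bsub>M\<^esub>"
      by (simp add: \<pi>.hom_int_pow x_def y_def)
    then have "h (gy [^]\<^bsub>F\<^esub> b \<otimes>\<^bsub>F\<^esub> gx [^]\<^bsub>F\<^esub> a) = \<one>\<^bsub>?K\<^esub>"
      using \<pi>_one[of "gy [^]\<^bsub>F\<^esub> b \<otimes>\<^bsub>F\<^esub> gx [^]\<^bsub>F\<^esub> a"] by (intro kernel) (simp del: \<pi>.hom_mult)
    then show "int p dvd b \<and> int q dvd a"
      by (intro K.y_x_pow_eq_one) (simp add: h.hom_int_pow hx hy)
  next
    assume "int p dvd b \<and> int q dvd a"
    then show "y [^]\<^bsub>M\<^esub> b \<otimes>\<^bsub>M\<^esub> x [^]\<^bsub>M\<^esub> a = \<one>\<^bsub>M\<^esub>"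
      using M.int_pow_eqI[of x "int q" a 0] M.int_pow_eqI[of y "int p" b 0] xq yp
      by (simp add: int_pow_int)
  qed

  have conj_int: "x \<otimes>\<^bsub>M\<^esub> y = y \<otimes>\<^bsub>M\<^esub> x [^]\<^bsub>M\<^esub> (1 + int p ^ (n - 1 - 1))"
    using rel int_pow_int[of M x "r + 1"] by (simp add: r_def add.commute numeral_2_eq_2 del: nat_pow_Suc)
  interpret rels: modular_relations M "int p" "n - 1" x y
    using n n4 prime conj_int eq_one by unfold_locales (auto simp: q_def)
  \<comment> \<open>The preimage of the set of normal forms. The formulas for products and inverses
    make it a subgroup, and it contains both generators, so it is the whole free group.\<close>
  define H where "H = {g \<in> carrier F. \<exists>b a. \<pi> g = rels.elt b a}"
  have "subgroup H F"
  proof (rule F.subgroupI)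
    show "H \<subseteq> carrier F" by (auto simp: H_def)
    have "\<pi> \<one>\<^bsub>F\<^esub> = rels.elt 0 0" by (simp add: rels.elt_zero)
    then have "\<one>\<^bsub>F\<^esub> \<in> H" unfolding H_def by blast
    then show "H \<noteq> {}" by blast
  next
    fix g assume "g \<in> H"
    then obtain b a where g: "g \<in> carrier F" "\<pi> g = rels.elt b a"
      unfolding H_def by blast
    then have "\<pi> (inv\<^bsub>F\<^esub> g) = rels.elt (- b) (- a + a * b * rels.r)"
      using rels.elt_inv by simp
    then show "inv\<^bsub>F\<^esub> g \<in> H"
      unfolding H_def using g by blast
  next
    fix g k assume "g \<in> H" "k \<in> H"
    then obtain b a d c where gk: "g \<in> carrier F" "\<pi> g = rels.elt b a"
      "k \<in> carrier F" "\<pi> k = rels.elt d c"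
      unfolding H_def by blast
    then have "\<pi> (g \<otimes>\<^bsub>F\<^esub> k) = rels.elt (b + d) (a + c + a * d * rels.r)"
      using rels.elt_mult by simp
    then show "g \<otimes>\<^bsub>F\<^esub> k \<in> H"
      unfolding H_def using gk by blast
  qed
  moreover have "free_gen c \<in> H" for c
  proof (cases c)
    case Gen_x
    have "\<pi> gx = rels.elt 0 1" by (simp add: rels.elt_def flip: x_def)
    then show ?thesis unfolding Gen_x gx_def[symmetric] H_def using gxy by blast
  next
    case Gen_y
    have "\<pi> gy = rels.elt 1 0" by (simp add: rels.elt_def flip: y_def)
    then show ?thesis unfolding Gen_y gy_def[symmetric] H_def using gxy by blast
  qed
  ultimately have H: "H = carrier F"
    unfolding F_def by (rule free_group_generated)
  have "modular_group M (int p) (n - 1) x y"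
  proof unfold_locales
    fix A assume "A \<in> carrier M"
    then obtain g where "g \<in> carrier F" "A = \<pi> g"
      by (auto simp: M_def FactGroup_def RCOSETS_def \<pi>_def)
    then show "\<exists>b a. A = rels.elt b a"
      using H unfolding H_def by blast
  qed
  then show thesis
    using that M by simp
qed

theorem theorem3p3p2:
  fixes p n :: nat
  assumes "Factorial_Ring.prime p"
    and "odd p \<Longrightarrow> n \<ge> 3"
    and "p = 2 \<Longrightarrow> n \<ge> 4"
  shows "cdeg (M_group p n) =
    ((real n - 1) * real p + 2) / ((real n - 1) * real p + real n + 1)"
proof -
  \<comment> \<open>A prime is odd or equal to 2, and either case gives this bound.\<close>
  have n: "n \<ge> 3"
    using assms prime_odd_nat[of p] prime_ge_2_nat[of p] by force
  obtain x y where "modular_group (M_group p n) (int p) (n - 1) x y"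
    using modular_group_M_group[OF assms(1) n assms(3)] by blast
  then interpret modular_group "M_group p n" "int p" "n - 1" x y .
  have "real (card (cyclic_subgroups (M_group p n))) = (real n - 1) * real p + 2"
    using n by (simp add: card_cyclic_subgroups of_nat_diff)
  \<comment> \<open>With \<open>m = n - 1\<close> the summand \<open>m + 2\<close> becomes
    \<open>n + 1\<close>.\<close>
  moreover have "real (card (subgroups (M_group p n))) = (real n - 1) * real p + real n + 1"
    using n by (simp add: card_subgroups of_nat_diff)
  ultimately show ?thesis
    by (simp add: cdeg_def)
qed

end
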